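(* Let $\lambda>0$ and $y_i=\theta^*_i+\epsilon_i$, $1\le i\le n$, where $\theta^*\in\mathbb{R}^n$ is piecewise constant with $K$ pieces of lengths $m_1,\dots,m_K$ (see context) and $\epsilon_1,\dots,\epsilon_n$ are i.i.d. with mean zero and sub-Gaussian with parameter $\sigma>0$. Let $$\hat\theta=\arg\min_{\theta\in\mathbb{R}^n}\ \frac12\sum_{i=1}^n(y_i-\theta_i)^2+\lambda\sum_{i=1}^{n-1}|\theta_i-\theta_{i+1}|.$$ Then for all $\delta\in(0,n(\log2/e)^2)$, with probability at least $1-4\big(1+\tfrac{24}{(\log2)^2}\big)\delta$, $$\begin{aligned}\sum_{i=1}^n|\hat\theta_i-\theta^*_i|^2\le{}&192\sigma^2\Big(\log\log(2n)+\frac12\log\frac n\delta\Big)\Big(K+\sum_{k=1}^K\log\frac{m_k}{2}\Big)\\&+24n\sigma^4\,\frac{(\log\log(2n))^2+\frac14(\log\frac n\delta)^2}{\lambda^2}+12K\sigma^2\log\frac n\delta+24\lambda^2\sum_{k=1}^K\frac1{m_k}.\end{aligned}$$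
   Context: A random variable $X$ is sub-Gaussian with parameter $\sigma$ if $\mathbb{E}[e^{s(X-\mathbb{E}X)}]\le e^{\sigma^2s^2/2}$ for all $s\in\mathbb{R}$. $\theta^*$ is piecewise constant with $K$ pieces: there are integers $1=n_1<n_2<\cdots<n_K<n$, with the convention $n_{K+1}=n+1$, such that $\theta^*_{n_k}=\theta^*_{n_k+1}=\cdots=\theta^*_{n_{k+1}-1}$ for each $1\le k\le K$. The length of the $k$-th piece is $m_k=n_{k+1}-n_k$. $\log$ is the natural logarithm. *)

theory Defs
  imports "HOL-Probability.Probability"
begin

text \<open>Vectors in \<open>\<real>\<^sup>n\<close> are functions on the indices \<open>{1..n}\<close>, taken extensional where
  a canonical representative is needed.\<close>

text \<open>The integrability conditions are part of the meaning of the moment bound: the Bochner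
  integral of a non-integrable function is \<open>0\<close>, so the inequality alone would be vacuous there.\<close>

definition sub_gaussian :: "'w measure \<Rightarrow> ('w \<Rightarrow> real) \<Rightarrow> real \<Rightarrow> bool" where
  "sub_gaussian M X \<sigma> \<longleftrightarrow>
     integrable M X \<and>
     (\<forall>s. integrable M (\<lambda>\<omega>. exp (s * (X \<omega> - (\<integral>\<omega>. X \<omega> \<partial>M)))) \<and>
          (\<integral>\<omega>. exp (s * (X \<omega> - (\<integral>\<omega>. X \<omega> \<partial>M))) \<partial>M) \<le> exp (\<sigma>\<^sup>2 * s\<^sup>2 / 2))"

text \<open>\<open>c 1, \<dots>, c K\<close> are the left end points of the pieces and \<open>c (K + 1) = n + 1\<close>.
  Values on adjacent pieces may coincide.\<close>

definition piecewise_constant ::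
    "nat \<Rightarrow> nat \<Rightarrow> (nat \<Rightarrow> nat) \<Rightarrow> (nat \<Rightarrow> real) \<Rightarrow> bool" where
  "piecewise_constant n K c \<theta> \<longleftrightarrow>
     1 \<le> K \<and> c 1 = 1 \<and> strict_mono_on {1..K} c \<and> c K < n \<and> c (K + 1) = n + 1 \<and>
     (\<forall>k\<in>{1..K}. \<forall>i\<in>{c k..<c (k + 1)}. \<theta> i = \<theta> (c k))"

definition piece_length :: "(nat \<Rightarrow> nat) \<Rightarrow> nat \<Rightarrow> nat" where
  "piece_length c k = c (k + 1) - c k"

definition tv_objective :: "nat \<Rightarrow> real \<Rightarrow> (nat \<Rightarrow> real) \<Rightarrow> (nat \<Rightarrow> real) \<Rightarrow> real" where
  "tv_objective n lam y \<theta> =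
     1 / 2 * (\<Sum>i=1..n. (y i - \<theta> i)\<^sup>2) + lam * (\<Sum>i=1..<n. \<bar>\<theta> i - \<theta> (i + 1)\<bar>)"

definition tv_estimator :: "nat \<Rightarrow> real \<Rightarrow> (nat \<Rightarrow> real) \<Rightarrow> (nat \<Rightarrow> real)" where
  "tv_estimator n lam y = arg_min (tv_objective n lam y) (\<lambda>\<theta>. \<theta> \<in> {1..n} \<rightarrow>\<^sub>E UNIV)"

end

theory Submission
  imports Defs
begin

text \<open>
  The error of total variation denoising is controlled pathwise, and probability enters only through
  the sums of the noise over index intervals.

  Fix a piece \<open>{a..b}\<close> on which the signal has the value \<open>v\<close>, an index \<open>i\<close> in it, and the maximal interval
  \<open>{l..r}\<close> around \<open>i\<close> inside the piece on which the minimizer \<open>u\<close> is at least \<open>u i\<close>. Lowering \<open>u\<close> a little on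
  \<open>{l..r}\<close> cannot decrease the objective. At an end of \<open>{l..r}\<close> interior to the piece the move reduces
  the variation; at an end shared with the piece it increases it by at most the size of the move.
  Hence \<open>u i - v\<close> is at most the mean of the noise over \<open>{l..r}\<close>, plus \<open>lam * C / (r - l + 1)\<close> where
  \<open>C\<close> is \<open>- 2\<close>, \<open>0\<close> or \<open>2\<close> if the interval shares no, one or both ends with the piece
  (\<open>tv_minimizer_run_sum\<close>).

  If every noise sum over \<open>m\<close> consecutive indices is at most \<open>A * sqrt m\<close> in absolute value, the three cases bound \<open>u i - v\<close> by
  \<open>A\<^sup>2 / (8 * lam)\<close>, by \<open>A / sqrt d\<close> with \<open>d\<close> the number of indices from \<open>i\<close> to an end of the piece, and by
  \<open>A / sqrt m + 2 * lam / m\<close> with \<open>m\<close> the length of the piece (\<open>upper_error_bound\<close>). The lower bound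
  follows by negating data and minimizer. Squaring and summing gives \<open>n * A ^ 4 / (64 * lam\<^sup>2)\<close>, harmonic
  sums of order \<open>A\<^sup>2 * ln m\<close>, and terms of order \<open>A\<^sup>2 + lam\<^sup>2 / m\<close>, for each piece of length \<open>m\<close>
  (\<open>tv_error_bound\<close>).

  Chernoff bounds for sub-Gaussian sums and a union bound over all intervals show that the noise
  condition with \<open>A\<^sup>2 = 4 * \<sigma>\<^sup>2 * ln (n / \<delta>)\<close> fails with probability at most \<open>2 * \<delta>\<^sup>2\<close>
  (\<open>interval_sums_bounded\<close>). The constants of the theorem leave ample room for this choice
  (\<open>error_bound_le\<close>).

  Finally, the event in question has to be measurable. The minimizer exists by compactness and is a
  nonexpansive, hence continuous, function of the data (\<open>tv_minimizer_nonexpansive\<close>).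
\<close>

section \<open>Minimizers of the total variation objective\<close>

definition variation :: "nat \<Rightarrow> (nat \<Rightarrow> real) \<Rightarrow> real" where
  "variation n \<theta> = (\<Sum>j=1..<n. \<bar>\<theta> j - \<theta> (j + 1)\<bar>)"

text \<open>The competitors \<open>w\<close> are arbitrary functions, not only extensional ones: the objective sees only
  \<open>{1..n}\<close>, and in this form the notion is stable under negation and can be tested against any
  perturbation.\<close>

definition tv_minimizer :: "nat \<Rightarrow> real \<Rightarrow> (nat \<Rightarrow> real) \<Rightarrow> (nat \<Rightarrow> real) \<Rightarrow> bool" where
  "tv_minimizer n lam y u \<longleftrightarrow> (\<forall>w. tv_objective n lam y u \<le> tv_objective n lam y w)"

lemma tv_objective_variation:
  "tv_objective n lam y \<theta> = 1 / 2 * (\<Sum>i=1..n. (y i - \<theta> i)\<^sup>2) + lam * variation n \<theta>"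
  by (simp add: tv_objective_def variation_def)

lemma tv_objective_cong:
  assumes "\<And>i. i \<in> {1..n} \<Longrightarrow> y i = z i" "\<And>i. i \<in> {1..n} \<Longrightarrow> u i = w i"
  shows "tv_objective n lam y u = tv_objective n lam z w"
proof -
  have "(\<Sum>i=1..n. (y i - u i)\<^sup>2) = (\<Sum>i=1..n. (z i - w i)\<^sup>2)"
    by (rule sum.cong) (simp_all add: assms)
  moreover have "(\<Sum>i=1..<n. \<bar>u i - u (i + 1)\<bar>) = (\<Sum>i=1..<n. \<bar>w i - w (i + 1)\<bar>)"
    by (rule sum.cong) (auto simp add: assms)
  ultimately show ?thesis by (simp add: tv_objective_def)
qed

text \<open>This symmetry turns upper bounds on the error into lower bounds.\<close>

lemma tv_minimizer_uminus:
  assumes "tv_minimizer n lam y u"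
  shows "tv_minimizer n lam (\<lambda>i. - y i) (\<lambda>i. - u i)"
proof -
  have flip: "tv_objective n lam (\<lambda>i. - y i) w = tv_objective n lam y (\<lambda>i. - w i)" for w
    by (simp add: tv_objective_def power2_eq_square algebra_simps abs_minus_commute)
  show ?thesis using assms by (simp add: tv_minimizer_def flip)
qed

lemma variation_convex:
  assumes "0 \<le> t" "t \<le> 1"
  shows "variation n (\<lambda>i. u i + t * (w i - u i)) \<le> (1 - t) * variation n u + t * variation n w"
proof -
  have "\<bar>(u j + t * (w j - u j)) - (u (j + 1) + t * (w (j + 1) - u (j + 1)))\<bar>
      \<le> (1 - t) * \<bar>u j - u (j + 1)\<bar> + t * \<bar>w j - w (j + 1)\<bar>" for j
  proof -
    have "(u j + t * (w j - u j)) - (u (j + 1) + t * (w (j + 1) - u (j + 1)))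
        = (1 - t) * (u j - u (j + 1)) + t * (w j - w (j + 1))" by (simp add: algebra_simps)
    also have "\<bar>\<dots>\<bar> \<le> \<bar>(1 - t) * (u j - u (j + 1))\<bar> + \<bar>t * (w j - w (j + 1))\<bar>"
      by (rule abs_triangle_ineq)
    finally show ?thesis using assms by (simp add: abs_mult)
  qed
  then have "variation n (\<lambda>i. u i + t * (w i - u i))
      \<le> (\<Sum>j=1..<n. (1 - t) * \<bar>u j - u (j + 1)\<bar> + t * \<bar>w j - w (j + 1)\<bar>)"
    unfolding variation_def by (intro sum_mono)
  then show ?thesis by (simp add: variation_def sum.distrib sum_distrib_left)
qed

lemma nonneg_slope_of_quadratic:
  fixes a b :: real
  assumes "\<And>t. 0 < t \<Longrightarrow> t \<le> 1 \<Longrightarrow> 0 \<le> t * a + t\<^sup>2 * b"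
  shows "0 \<le> a"
proof (rule ccontr)
  assume "\<not> 0 \<le> a"
  then have a: "a < 0" by simp
  define t where "t = min 1 (- a / (2 * (\<bar>b\<bar> + 1)))"
  have t: "0 < t" "t \<le> 1" using a by (simp_all add: t_def divide_neg_pos)
  have "t \<le> - a / (2 * (\<bar>b\<bar> + 1))" by (simp add: t_def)
  then have tb: "2 * (t * (\<bar>b\<bar> + 1)) \<le> - a" by (subst (asm) pos_le_divide_eq) (auto simp: algebra_simps)
  have "t * b \<le> t * (\<bar>b\<bar> + 1)" using t by (intro mult_left_mono) auto
  also have "\<dots> \<le> - a / 2" using tb by linarith
  finally have "a + t * b < 0" using a by linarith
  then have "t * (a + t * b) < 0" using t(1) by (simp add: mult_pos_neg)
  then show False using assms[OF t(1,2)] by (simp add: power2_eq_square algebra_simps)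
qed

text \<open>The first-order optimality condition, obtained by moving from \<open>u\<close> a small way towards \<open>w\<close>:
  the change of the quadratic part is linear up to second order, and convexity controls the change of
  the variation.\<close>

lemma tv_minimizer_variational_inequality:
  assumes min: "tv_minimizer n lam y u" and "0 < lam"
  shows "(\<Sum>i=1..n. (y i - u i) * (w i - u i)) \<le> lam * (variation n w - variation n u)"
proof -
  define P where "P = (\<Sum>i=1..n. (y i - u i) * (w i - u i))"
  define Q where "Q = (\<Sum>i=1..n. (w i - u i)\<^sup>2)"
  have "0 \<le> t * (lam * (variation n w - variation n u) - P) + t\<^sup>2 * (Q / 2)"
    if t: "0 < t" "t \<le> 1" for t
  proof -
    let ?v = "\<lambda>i. u i + t * (w i - u i)"
    have "(\<Sum>i=1..n. (y i - ?v i)\<^sup>2) = (\<Sum>i=1..n. (y i - u i)\<^sup>2 - 2 * t * ((y i - u i) * (w i - u i)) + t\<^sup>2 * (w i - u i)\<^sup>2)"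
      by (intro sum.cong) (simp_all add: power2_eq_square algebra_simps)
    also have "\<dots> = (\<Sum>i=1..n. (y i - u i)\<^sup>2) - 2 * t * P + t\<^sup>2 * Q"
      by (simp add: P_def Q_def sum.distrib sum_subtractf sum_distrib_left)
    finally have fit: "(\<Sum>i=1..n. (y i - ?v i)\<^sup>2) = (\<Sum>i=1..n. (y i - u i)\<^sup>2) - 2 * t * P + t\<^sup>2 * Q" .
    define V where "V = variation n ?v"
    have "lam * V \<le> lam * ((1 - t) * variation n u + t * variation n w)"
      unfolding V_def using t \<open>0 < lam\<close> by (intro mult_left_mono variation_convex) auto
    moreover have "tv_objective n lam y u \<le> tv_objective n lam y ?v"
      using min by (simp add: tv_minimizer_def)
    then have "1 / 2 * (\<Sum>i=1..n. (y i - u i)\<^sup>2) + lam * variation n u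
        \<le> 1 / 2 * ((\<Sum>i=1..n. (y i - u i)\<^sup>2) - 2 * t * P + t\<^sup>2 * Q) + lam * V"
      by (simp only: tv_objective_variation fit V_def)
    ultimately show ?thesis by (simp add: algebra_simps)
  qed
  then have "0 \<le> lam * (variation n w - variation n u) - P" by (rule nonneg_slope_of_quadratic)
  then show ?thesis by (simp add: P_def)
qed

text \<open>Denoising is a proximal map, hence nonexpansive. This gives uniqueness of the minimizer and its
  continuous dependence on the data, and thereby measurability of the estimator.\<close>

lemma tv_minimizer_nonexpansive:
  assumes u: "tv_minimizer n lam y u" and v: "tv_minimizer n lam z v" and "0 < lam"
  shows "(\<Sum>i=1..n. (u i - v i)\<^sup>2) \<le> (\<Sum>i=1..n. (y i - z i)\<^sup>2)"
proof -
  have "(\<Sum>i=1..n. (y i - u i) * (v i - u i)) + (\<Sum>i=1..n. (z i - v i) * (u i - v i)) \<le> 0"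
    using tv_minimizer_variational_inequality[OF u \<open>0 < lam\<close>, of v]
      tv_minimizer_variational_inequality[OF v \<open>0 < lam\<close>, of u] by (simp add: algebra_simps)
  then have "(\<Sum>i=1..n. (y i - u i) * (v i - u i) + (z i - v i) * (u i - v i)) \<le> 0"
    by (simp add: sum.distrib)
  moreover have "(u i - v i)\<^sup>2 \<le> 2 * ((y i - u i) * (v i - u i) + (z i - v i) * (u i - v i)) + (y i - z i)\<^sup>2" for i
  proof -
    have "0 \<le> ((u i - v i) - (y i - z i))\<^sup>2" by simp
    then show ?thesis by (simp add: power2_eq_square algebra_simps)
  qed
  then have "(\<Sum>i=1..n. (u i - v i)\<^sup>2)
      \<le> (\<Sum>i=1..n. 2 * ((y i - u i) * (v i - u i) + (z i - v i) * (u i - v i)) + (y i - z i)\<^sup>2)"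
    by (intro sum_mono)
  then have "(\<Sum>i=1..n. (u i - v i)\<^sup>2) \<le> 2 * (\<Sum>i=1..n. (y i - u i) * (v i - u i) + (z i - v i) * (u i - v i))
      + (\<Sum>i=1..n. (y i - z i)\<^sup>2)"
    by (simp add: sum.distrib sum_distrib_left)
  ultimately show ?thesis by linarith
qed

lemma continuous_on_tv_objective: "continuous_on UNIV (tv_objective n lam y)"
  unfolding tv_objective_def by (intro continuous_intros continuous_on_product_coordinates)

text \<open>Outside a large cube the objective exceeds its value at \<open>0\<close>, and on the cube (a compact set by
  Tychonoff's theorem) it attains its minimum.\<close>

lemma ex_tv_minimizer:
  assumes "0 < lam"
  shows "\<exists>u \<in> {1..n} \<rightarrow>\<^sub>E UNIV. tv_minimizer n lam y u"
proof -
  define S where "S = (\<Sum>i=1..n. (y i)\<^sup>2)"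
  have S0: "0 \<le> S" by (simp add: S_def sum_nonneg)
  define C where "C i = (if i \<in> {1..n} then {- (2 * sqrt S)..2 * sqrt S} else {undefined :: real})" for i
  let ?B = "Pi\<^sub>E UNIV C"
  have "compactin (product_topology (\<lambda>_. euclidean) UNIV) ?B"
    by (simp add: compactin_PiE C_def)
  then have comp: "compact ?B"
    by (simp add: euclidean_product_topology)
  define z :: "nat \<Rightarrow> real" where "z i = (if i \<in> {1..n} then 0 else undefined)" for i
  have z: "z \<in> ?B" using S0 by (auto simp: z_def C_def PiE_iff)
  obtain u where u: "u \<in> ?B" "\<And>w. w \<in> ?B \<Longrightarrow> tv_objective n lam y u \<le> tv_objective n lam y w"
  proof -
    have "continuous_on ?B (tv_objective n lam y)"
      using continuous_on_tv_objective by (rule continuous_on_subset) simp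
    then show ?thesis using continuous_attains_inf[OF comp] z that by (metis empty_iff)
  qed
  have "tv_objective n lam y u \<le> tv_objective n lam y w" for w
  proof (cases "\<forall>i\<in>{1..n}. \<bar>w i\<bar> \<le> 2 * sqrt S")
    case True
    let ?w = "restrict w {1..n}"
    have "?w \<in> ?B" using True by (force simp: C_def PiE_iff abs_le_iff)
    then have "tv_objective n lam y u \<le> tv_objective n lam y ?w" by (rule u)
    also have "\<dots> = tv_objective n lam y w" by (rule tv_objective_cong) auto
    finally show ?thesis .
  next
    case False
    then obtain i where i: "i \<in> {1..n}" "2 * sqrt S < \<bar>w i\<bar>" by force
    have "(y i)\<^sup>2 \<le> S" unfolding S_def using i(1) by (intro member_le_sum) auto
    then have "\<bar>y i\<bar> \<le> sqrt S" by (simp add: real_le_rsqrt)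
    then have "sqrt S \<le> \<bar>y i - w i\<bar>" using i(2) by linarith
    then have "(sqrt S)\<^sup>2 \<le> (y i - w i)\<^sup>2" using S0 by (intro iffD2[OF abs_le_square_iff[symmetric]]) simp
    then have "S \<le> (y i - w i)\<^sup>2" using S0 by simp
    also have "\<dots> \<le> (\<Sum>i=1..n. (y i - w i)\<^sup>2)" using i(1) by (intro member_le_sum) auto
    finally have "S \<le> (\<Sum>i=1..n. (y i - w i)\<^sup>2)" .
    moreover have "tv_objective n lam y z = 1 / 2 * S" by (simp add: tv_objective_def z_def S_def)
    moreover have "0 \<le> lam * variation n w" using assms by (simp add: variation_def sum_nonneg)
    ultimately have "tv_objective n lam y z \<le> tv_objective n lam y w"
      by (simp add: tv_objective_variation)
    then show ?thesis using u(2)[OF z] by linarith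
  qed
  moreover have "u j = undefined" if "j \<notin> {1..n}" for j
    using PiE_mem[OF u(1) UNIV_I, of j] that unfolding C_def by (metis singletonD)
  then have "u \<in> {1..n} \<rightarrow>\<^sub>E UNIV" by (intro PiE_I) auto
  ultimately show ?thesis unfolding tv_minimizer_def by blast
qed

lemma tv_minimizer_tv_estimator:
  assumes "0 < lam"
  shows "tv_minimizer n lam y (tv_estimator n lam y)"
proof -
  obtain u where u: "u \<in> {1..n} \<rightarrow>\<^sub>E UNIV" "tv_minimizer n lam y u" using ex_tv_minimizer[OF assms] by blast
  show ?thesis unfolding tv_estimator_def
  proof (rule arg_minI[where P = "\<lambda>\<theta>. \<theta> \<in> {1..n} \<rightarrow>\<^sub>E UNIV", OF u(1)])
    show "\<not> tv_objective n lam y w < tv_objective n lam y u" for w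
      using u(2) by (simp add: tv_minimizer_def not_less)
    show "tv_minimizer n lam y x" if "\<forall>w. w \<in> {1..n} \<rightarrow>\<^sub>E UNIV \<longrightarrow> \<not> tv_objective n lam y w < tv_objective n lam y x" for x
      using that u by (meson le_less_linear order_trans tv_minimizer_def)
  qed
qed

lemma tv_estimator_cong:
  assumes "\<And>i. i \<in> {1..n} \<Longrightarrow> y i = z i"
  shows "tv_estimator n lam y = tv_estimator n lam z"
proof -
  have "tv_objective n lam y = tv_objective n lam z"
    using assms by (intro ext tv_objective_cong) auto
  then show ?thesis by (simp add: tv_estimator_def)
qed

lemma continuous_on_tv_estimator:
  assumes "0 < lam" "i \<in> {1..n}"
  shows "continuous_on UNIV (\<lambda>y. tv_estimator n lam y i)"
  unfolding continuous_on_def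
proof
  fix y0 :: "nat \<Rightarrow> real"
  let ?D = "\<lambda>y. sqrt (\<Sum>j=1..n. (y j - y0 j)\<^sup>2)"
  have "continuous_on UNIV ?D" by (intro continuous_intros continuous_on_product_coordinates)
  then have "(?D \<longlongrightarrow> ?D y0) (at y0)" unfolding continuous_on_def by blast
  then have lim: "(?D \<longlongrightarrow> 0) (at y0)" by simp
  have "\<bar>tv_estimator n lam y i - tv_estimator n lam y0 i\<bar> \<le> ?D y" for y
  proof -
    have "(tv_estimator n lam y i - tv_estimator n lam y0 i)\<^sup>2
        \<le> (\<Sum>j=1..n. (tv_estimator n lam y j - tv_estimator n lam y0 j)\<^sup>2)"
      using assms(2) by (intro member_le_sum) auto
    also have "\<dots> \<le> (\<Sum>j=1..n. (y j - y0 j)\<^sup>2)"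
      using assms(1) by (intro tv_minimizer_nonexpansive[of n lam y _ y0] tv_minimizer_tv_estimator)
    finally show ?thesis by (intro real_le_rsqrt) simp
  qed
  then have "((\<lambda>y. tv_estimator n lam y i - tv_estimator n lam y0 i) \<longlongrightarrow> 0) (at y0)"
    by (intro Lim_null_comparison[OF _ lim]) simp
  then show "((\<lambda>y. tv_estimator n lam y i) \<longlongrightarrow> tv_estimator n lam y0 i) (at y0)"
    by (simp add: LIM_zero_iff)
qed

section \<open>Pointwise error bound on a piece\<close>

lemma maximal_run:
  fixes a b i :: nat
  assumes "a \<le> i" "i \<le> b" "P i"
  obtains l r where "a \<le> l" "l \<le> i" "i \<le> r" "r \<le> b" "\<forall>j\<in>{l..r}. P j"
    "a < l \<Longrightarrow> \<not> P (l - 1)" "r < b \<Longrightarrow> \<not> P (r + 1)"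
proof -
  let ?L = "\<lambda>l. a \<le> l \<and> l \<le> i \<and> (\<forall>j\<in>{l..i}. P j)"
  let ?R = "\<lambda>r. i \<le> r \<and> r \<le> b \<and> (\<forall>j\<in>{i..r}. P j)"
  define l where "l = (LEAST l. ?L l)"
  define r where "r = (GREATEST r. ?R r)"
  have L: "?L l" unfolding l_def by (rule LeastI[of ?L i]) (use assms in auto)
  have R: "?R r" unfolding r_def by (rule GreatestI_nat[of ?R i b]) (use assms in auto)
  have "\<not> P (l - 1)" if "a < l"
  proof
    assume "P (l - 1)"
    moreover have "j = l - 1 \<or> j \<in> {l..i}" if "j \<in> {l - 1..i}" for j using that by auto
    ultimately have "\<forall>j\<in>{l - 1..i}. P j" using L by blast
    then have "?L (l - 1)" using L that by auto
    then have "l \<le> l - 1" unfolding l_def by (rule Least_le)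
    then show False using that by simp
  qed
  moreover have "\<not> P (r + 1)" if "r < b"
  proof
    assume "P (r + 1)"
    moreover have "j = r + 1 \<or> j \<in> {i..r}" if "j \<in> {i..r + 1}" for j using that by auto
    ultimately have "\<forall>j\<in>{i..r + 1}. P j" using R by blast
    then have "?R (r + 1)" using R that by auto
    then have "r + 1 \<le> r" unfolding r_def by (rule Greatest_le_nat[of ?R _ b]) auto
    then show False by simp
  qed
  moreover have "\<forall>j\<in>{l..r}. P j"
  proof
    fix j assume "j \<in> {l..r}"
    then show "P j" using L R by (cases "j \<le> i") auto
  qed
  ultimately show ?thesis using that L R by blast
qed

text \<open>Lowering \<open>u\<close> by \<open>\<eta>\<close> on \<open>{l..r}\<close> saves \<open>\<eta>\<close> of variation at each end at which \<open>u\<close> has an upward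
  step into the run, and costs at most \<open>\<eta>\<close> at an end that coincides with an end of the surrounding
  interval \<open>{a..b}\<close>, where nothing is known about the step.\<close>

lemma tv_minimizer_run_sum:
  fixes a b l r n :: nat
  assumes min: "tv_minimizer n lam y u" and lam: "0 < lam"
    and ord: "1 \<le> a" "a \<le> l" "l \<le> r" "r \<le> b" "b \<le> n"
    and left: "a < l \<Longrightarrow> u (l - 1) < u l" and right: "r < b \<Longrightarrow> u (r + 1) < u r"
  shows "(\<Sum>j=l..r. u j) \<le> (\<Sum>j=l..r. y j) + lam * ((if l = a then 1 else - 1) + (if r = b then 1 else - 1))"
proof -
  define sl sr :: real where "sl = (if l = a then 1 else - 1)" and "sr = (if r = b then 1 else - 1)"
  define \<eta> where "\<eta> = min (if a < l then u l - u (l - 1) else 1) (if r < b then u r - u (r + 1) else 1)"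
  have \<eta>: "0 < \<eta>" "a < l \<Longrightarrow> u (l - 1) + \<eta> \<le> u l" "r < b \<Longrightarrow> u (r + 1) + \<eta> \<le> u r"
    using left right by (auto simp: \<eta>_def)
  define w where "w j = (if j \<in> {l..r} then u j - \<eta> else u j)" for j
  have "variation n w - variation n u
      = (\<Sum>j=1..<n. \<bar>w j - w (j + 1)\<bar> - \<bar>u j - u (j + 1)\<bar>)"
    by (simp add: variation_def sum_subtractf)
  also have "\<dots> \<le> (\<Sum>j=1..<n. (if j = l - 1 then \<eta> * sl else 0) + (if j = r then \<eta> * sr else 0))"
  proof (rule sum_mono)
    fix j assume j: "j \<in> {1..<n}"
    consider "j = l - 1" | "j = r" | "j \<noteq> l - 1" "j \<noteq> r" by blast
    then show "\<bar>w j - w (j + 1)\<bar> - \<bar>u j - u (j + 1)\<bar>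
        \<le> (if j = l - 1 then \<eta> * sl else 0) + (if j = r then \<eta> * sr else 0)"
    proof cases
      case 1
      then have "j \<noteq> r" "j + 1 = l" using j ord by auto
      then have "w j = u j" "w (j + 1) = u (j + 1) - \<eta>" using ord by (auto simp: w_def)
      then show ?thesis using 1 \<open>j \<noteq> r\<close> \<open>j + 1 = l\<close> \<eta> ord by (cases "l = a") (auto simp: sl_def)
    next
      case 2
      then have "w j = u j - \<eta>" "w (j + 1) = u (j + 1)" "j \<noteq> l - 1" using ord by (auto simp: w_def)
      then show ?thesis using 2 \<eta> ord by (cases "r = b") (auto simp: sr_def)
    next
      case 3
      then have "j \<in> {l..r} \<longleftrightarrow> j + 1 \<in> {l..r}" by auto
      then show ?thesis using 3 by (auto simp: w_def)
    qed
  qed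
  also have "\<dots> = (if l - 1 \<in> {1..<n} then \<eta> * sl else 0) + (if r \<in> {1..<n} then \<eta> * sr else 0)"
    by (simp add: sum.distrib)
  also have "\<dots> \<le> \<eta> * sl + \<eta> * sr"
    \<comment> \<open>A run that reaches index \<open>1\<close> or \<open>n\<close> reaches the end of \<open>{a..b}\<close>, so its sign is \<open>1\<close>.\<close>
    using ord \<eta>(1) by (auto simp: sl_def sr_def)
  finally have "variation n w - variation n u \<le> \<eta> * (sl + sr)" by (simp add: algebra_simps)
  then have "lam * (variation n w - variation n u) \<le> lam * (\<eta> * (sl + sr))"
    using lam by (intro mult_left_mono) auto
  moreover have "(\<Sum>j=1..n. (y j - u j) * (w j - u j)) = - (\<eta> * (\<Sum>j=l..r. y j - u j))"
  proof -
    have "(\<Sum>j=1..n. (y j - u j) * (w j - u j)) = (\<Sum>j=1..n. if j \<in> {l..r} then - (\<eta> * (y j - u j)) else 0)"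
      by (intro sum.cong) (auto simp: w_def)
    also have "\<dots> = (\<Sum>j\<in>{1..n} \<inter> {l..r}. - (\<eta> * (y j - u j)))" by (rule sum.inter_restrict[symmetric]) simp
    also have "{1..n} \<inter> {l..r} = {l..r}" using ord by auto
    finally show ?thesis by (simp add: sum_negf sum_distrib_left)
  qed
  ultimately have "\<eta> * (- (\<Sum>j=l..r. y j - u j)) \<le> \<eta> * (lam * (sl + sr))"
    using tv_minimizer_variational_inequality[OF min lam, of w] by (simp add: algebra_simps)
  then show ?thesis using \<eta>(1) by (simp add: sl_def sr_def sum_subtractf)
qed

text \<open>The squared error allowed at index \<open>i\<close> of a piece \<open>{a..b}\<close>. The first summand pays for runs in the
  interior of the piece, the second for runs that touch one end of it and so have length at least the
  number of indices from \<open>i\<close> to that end, the third for a run that is the whole piece.\<close>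

definition piece_bound :: "real \<Rightarrow> real \<Rightarrow> nat \<Rightarrow> nat \<Rightarrow> nat \<Rightarrow> real" where
  "piece_bound lam A a b i = A ^ 4 / (64 * lam\<^sup>2)
     + A\<^sup>2 * (1 / real (i - a + 1) + 1 / real (b - i + 1))
     + (2 * A\<^sup>2 / real (b - a + 1) + 8 * lam\<^sup>2 / (real (b - a + 1))\<^sup>2)"

text \<open>Let \<open>{l..r}\<close>, of length \<open>m\<close>, be the maximal run around \<open>i\<close> inside the piece on which
  \<open>u\<close> is at least \<open>u i\<close>. Then \<open>u i - v\<close> is at most the mean of the noise over the run, which is at most
  \<open>A / sqrt m\<close>, plus \<open>lam * C / m\<close> with \<open>C\<close> in \<open>{- 2, 0, 2}\<close> counting the signs of the two ends. In the
  interior \<open>C = - 2\<close>, and the penalty beats the noise of short runs: this makes the bound independent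
  of the length of the run. At one end of the piece the signs cancel.\<close>

lemma upper_error_bound:
  assumes min: "tv_minimizer n lam y u" and lam: "0 < lam" and A: "0 \<le> A"
    and noise: "\<And>l r. 1 \<le> l \<Longrightarrow> l \<le> r \<Longrightarrow> r \<le> n \<Longrightarrow>
        (\<Sum>j=l..r. y j - \<theta> j) \<le> A * sqrt (real (r - l + 1))"
    and const: "\<And>j. j \<in> {a..b} \<Longrightarrow> \<theta> j = v"
    and i: "1 \<le> a" "a \<le> i" "i \<le> b" "b \<le> n"
  shows "u i - v \<le> sqrt (piece_bound lam A a b i)"
proof -
  obtain l r where lr: "a \<le> l" "l \<le> i" "i \<le> r" "r \<le> b" "\<forall>j\<in>{l..r}. u i \<le> u j"
    "a < l \<Longrightarrow> \<not> u i \<le> u (l - 1)" "r < b \<Longrightarrow> \<not> u i \<le> u (r + 1)"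
    using maximal_run[of a i b "\<lambda>j. u i \<le> u j"] i by auto
  define m where "m = real (r - l + 1)"
  define C :: real where "C = (if l = a then 1 else - 1) + (if r = b then 1 else - 1)"
  have m: "1 \<le> m" by (simp add: m_def)
  have ends: "u i \<le> u l" "u i \<le> u r" using lr(2,3,5) by auto
  have left: "u (l - 1) < u l" if "a < l" using lr(6)[OF that] ends(1) by linarith
  have right: "u (r + 1) < u r" if "r < b" using lr(7)[OF that] ends(2) by linarith
  have run: "(\<Sum>j=l..r. u j) \<le> (\<Sum>j=l..r. y j) + lam * C"
    unfolding C_def using lr(1-4) i by (intro tv_minimizer_run_sum[OF min lam, of a l r b] left right) auto
  have card: "real (card {l..r}) = m" using lr by (simp add: m_def of_nat_diff)
  have "m * u i = (\<Sum>j=l..r. u i)" using card by simp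
  also have "\<dots> \<le> (\<Sum>j=l..r. u j)" using lr by (intro sum_mono) auto
  also note run
  also have "(\<Sum>j=l..r. y j) = (\<Sum>j=l..r. y j - \<theta> j) + (\<Sum>j=l..r. v)"
    using lr const by (simp add: sum_subtractf)
  also have "\<dots> = (\<Sum>j=l..r. y j - \<theta> j) + m * v" using card by simp
  finally have "m * (u i - v) \<le> A * sqrt m + lam * C"
    using noise[of l r] lr i by (simp add: m_def algebra_simps)
  then have "u i - v \<le> (A * sqrt m + lam * C) / m"
    using m by (simp add: pos_le_divide_eq mult.commute)
  also have "\<dots> = A * sqrt m / (sqrt m * sqrt m) + lam * C / m"
    using m by (simp add: add_divide_distrib)
  also have "A * sqrt m / (sqrt m * sqrt m) = A / sqrt m"
    using m by (intro nonzero_mult_divide_mult_cancel_right) simp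
  finally have err: "u i - v \<le> A / sqrt m + lam * C / m" .
  define B1 B2 B3 B4 where "B1 = A ^ 4 / (64 * lam\<^sup>2)" and "B2 = A\<^sup>2 / real (i - a + 1)"
    and "B3 = A\<^sup>2 / real (b - i + 1)"
    and "B4 = 2 * A\<^sup>2 / real (b - a + 1) + 8 * lam\<^sup>2 / (real (b - a + 1))\<^sup>2"
  have "0 \<le> B1" "0 \<le> B2" "0 \<le> B3" "0 \<le> B4" by (simp_all add: B1_def B2_def B3_def B4_def)
  moreover have "piece_bound lam A a b i = B1 + B2 + B3 + B4"
    by (simp add: piece_bound_def B1_def B2_def B3_def B4_def distrib_left)
  ultimately have "B1 \<le> piece_bound lam A a b i" "B2 \<le> piece_bound lam A a b i"
    "B3 \<le> piece_bound lam A a b i" "B4 \<le> piece_bound lam A a b i" by linarith+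
  note parts = this[THEN real_sqrt_le_mono]
  consider "a < l" "r < b" | "l = a" "r < b" | "a < l" "r = b" | "l = a" "r = b" using lr by linarith
  then show ?thesis
  proof cases
    case 1
    then have "u i - v \<le> A / sqrt m - 2 * lam / m" using err by (simp add: C_def mult.commute)
    also have "\<dots> \<le> A\<^sup>2 / (8 * lam)"
    proof -
      \<comment> \<open>The quadratic \<open>A * x - 2 * lam * x\<^sup>2\<close> in \<open>x = 1 / sqrt m\<close> is largest at \<open>x = A / (4 * lam)\<close>.\<close>
      define x where "x = 1 / sqrt m"
      have x: "A / sqrt m = A * x" "2 * lam / m = 2 * lam * x\<^sup>2"
        using m by (simp_all add: x_def power_divide)
      have "0 \<le> (A - 4 * lam * x)\<^sup>2" by simp
      then have "(A * x - 2 * lam * x\<^sup>2) * (8 * lam) \<le> A\<^sup>2" by (simp add: power2_eq_square algebra_simps)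
      then show ?thesis unfolding x using lam by (simp only: pos_le_divide_eq mult_pos_pos zero_less_numeral)
    qed
    also have "\<dots> \<le> sqrt B1"
    proof (rule real_le_rsqrt)
      have "A ^ 4 = (A\<^sup>2)\<^sup>2" by simp
      then show "(A\<^sup>2 / (8 * lam))\<^sup>2 \<le> B1" by (simp add: B1_def power_divide power_mult_distrib)
    qed
    also note parts(1)
    finally show ?thesis .
  next
    case 2
    then have "real (i - a + 1) \<le> m" unfolding m_def using lr by (intro of_nat_mono) simp
    then have "A\<^sup>2 / m \<le> B2" unfolding B2_def by (intro divide_left_mono) (use m in auto)
    then have "sqrt (A\<^sup>2 / m) \<le> sqrt B2" by (rule real_sqrt_le_mono)
    also note parts(2)
    finally have "A / sqrt m \<le> sqrt (piece_bound lam A a b i)" using A by (simp add: real_sqrt_divide)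
    moreover have "u i - v \<le> A / sqrt m" using err 2 by (simp add: C_def)
    ultimately show ?thesis by linarith
  next
    case 3
    then have "real (b - i + 1) \<le> m" unfolding m_def using lr by (intro of_nat_mono) simp
    then have "A\<^sup>2 / m \<le> B3" unfolding B3_def by (intro divide_left_mono) (use m in auto)
    then have "sqrt (A\<^sup>2 / m) \<le> sqrt B3" by (rule real_sqrt_le_mono)
    also note parts(3)
    finally have "A / sqrt m \<le> sqrt (piece_bound lam A a b i)" using A by (simp add: real_sqrt_divide)
    moreover have "u i - v \<le> A / sqrt m" using err 3 by (simp add: C_def)
    ultimately show ?thesis by linarith
  next
    case 4
    then have mab: "m = real (b - a + 1)" by (simp add: m_def)
    define p q where "p = A / sqrt m" and "q = 2 * lam / m"
    have "u i - v \<le> p + q" using err 4 by (simp add: C_def p_def q_def mult.commute)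
    also have "\<dots> \<le> sqrt (2 * p\<^sup>2 + 2 * q\<^sup>2)"
      using zero_le_power2[of "p - q"] by (intro real_le_rsqrt) (simp add: power2_eq_square algebra_simps)
    also have "2 * p\<^sup>2 + 2 * q\<^sup>2 = B4"
      unfolding B4_def mab[symmetric] using m by (simp add: p_def q_def power_divide power_mult_distrib)
    also note parts(4)
    finally show ?thesis .
  qed
qed

lemma squared_error_bound:
  assumes min: "tv_minimizer n lam y u" and lam: "0 < lam" and A: "0 \<le> A"
    and noise: "\<And>l r. 1 \<le> l \<Longrightarrow> l \<le> r \<Longrightarrow> r \<le> n \<Longrightarrow>
        \<bar>\<Sum>j=l..r. y j - \<theta> j\<bar> \<le> A * sqrt (real (r - l + 1))"
    and const: "\<And>j. j \<in> {a..b} \<Longrightarrow> \<theta> j = v"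
    and i: "1 \<le> a" "a \<le> i" "i \<le> b" "b \<le> n"
  shows "(u i - v)\<^sup>2 \<le> piece_bound lam A a b i"
proof -
  have "u i - v \<le> sqrt (piece_bound lam A a b i)"
    using noise by (intro upper_error_bound[OF min lam A _ const i]) (auto simp: abs_le_iff)
  moreover have "- u i - (- v) \<le> sqrt (piece_bound lam A a b i)"
  proof (rule upper_error_bound[OF tv_minimizer_uminus[OF min] lam A _ _ i])
    fix l r :: nat assume lr: "1 \<le> l" "l \<le> r" "r \<le> n"
    have "(\<Sum>j=l..r. - y j - (- \<theta> j)) = - (\<Sum>j=l..r. y j - \<theta> j)"
      by (simp add: sum_subtractf sum_negf)
    then show "(\<Sum>j=l..r. - y j - (- \<theta> j)) \<le> A * sqrt (real (r - l + 1))"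
      using noise[OF lr] by (simp add: abs_le_iff)
  qed (use const in auto)
  ultimately have "\<bar>u i - v\<bar> \<le> sqrt (piece_bound lam A a b i)" by linarith
  moreover from this have "0 \<le> piece_bound lam A a b i"
    by (metis abs_ge_zero order_trans real_sqrt_ge_0_iff)
  ultimately show ?thesis by (simp add: sqrt_ge_absD)
qed

section \<open>Summation over the pieces\<close>

lemma harm_le_one_plus_ln:
  assumes "1 \<le> m"
  shows "harm m \<le> 1 + ln (real m)"
proof -
  obtain k where k: "m = Suc k" using assms by (cases m) auto
  have "harm (Suc k) - ln (real (Suc k)) \<le> harm (Suc 0) - ln (real (Suc 0))"
    using decseqD[OF decseq_harm_diff_ln, of 0 k] by simp
  then show ?thesis by (simp add: k harm_expand)
qed

text \<open>The runs that touch an end of the piece contribute harmonic sums; they are the source of the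
  logarithm of the piece length.\<close>

lemma sum_piece_bound:
  assumes "a \<le> b"
  shows "(\<Sum>i=a..b. piece_bound lam A a b i)
    \<le> real (b - a + 1) * (A ^ 4 / (64 * lam\<^sup>2)) + A\<^sup>2 * (4 + 2 * ln (real (b - a + 1)))
        + 8 * lam\<^sup>2 * (1 / real (b - a + 1))"
proof -
  define m where "m = b - a + 1"
  have m: "1 \<le> m" "card {a..b} = m" using assms by (simp_all add: m_def)
  have left: "(\<Sum>i=a..b. 1 / real (i - a + 1)) = harm m"
    unfolding harm_def by (rule sum.reindex_bij_witness[where i = "\<lambda>k. k + a - 1" and j = "\<lambda>i. i - a + 1"])
      (use assms in \<open>auto simp: m_def field_simps\<close>)
  have right: "(\<Sum>i=a..b. 1 / real (b - i + 1)) = harm m"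
    unfolding harm_def by (rule sum.reindex_bij_witness[where i = "\<lambda>k. b + 1 - k" and j = "\<lambda>i. b - i + 1"])
      (use assms in \<open>auto simp: m_def field_simps\<close>)
  have "(\<Sum>i=a..b. piece_bound lam A a b i) = real m * (A ^ 4 / (64 * lam\<^sup>2))
      + A\<^sup>2 * ((\<Sum>i=a..b. 1 / real (i - a + 1)) + (\<Sum>i=a..b. 1 / real (b - i + 1)))
      + real m * (2 * A\<^sup>2 / real m + 8 * lam\<^sup>2 / (real m)\<^sup>2)"
    unfolding piece_bound_def m_def[symmetric] sum.distrib sum_distrib_left[symmetric] sum_constant m(2)
    by (simp only: distrib_left)
  also have "real m * (2 * A\<^sup>2 / real m + 8 * lam\<^sup>2 / (real m)\<^sup>2) = 2 * A\<^sup>2 + 8 * lam\<^sup>2 * (1 / real m)"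
    using m by (simp add: field_simps power2_eq_square)
  also have "A\<^sup>2 * ((\<Sum>i=a..b. 1 / real (i - a + 1)) + (\<Sum>i=a..b. 1 / real (b - i + 1)))
      \<le> A\<^sup>2 * (2 + 2 * ln (real m))"
    unfolding left right using harm_le_one_plus_ln[OF m(1)] by (intro mult_left_mono) auto
  finally show ?thesis unfolding m_def[symmetric] by (simp add: algebra_simps)
qed

lemma piecewise_constant_bounds:
  assumes pc: "piecewise_constant n K c \<theta>" and k: "k \<in> {1..K}"
  shows "1 \<le> c k" "c k < c (k + 1)" "c (k + 1) \<le> n + 1"
proof -
  have K: "1 \<le> K" "c 1 = 1" "c K < n" "c (K + 1) = n + 1" and mono: "strict_mono_on {1..K} c"
    using pc by (auto simp: piecewise_constant_def)
  have le: "c i \<le> c j" if "1 \<le> i" "i \<le> j" "j \<le> K" for i j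
    using strict_mono_onD[OF mono, of i j] that by (cases "i = j") auto
  show "1 \<le> c k" using le[of 1 k] k K by simp
  show "c k < c (k + 1)"
    using strict_mono_onD[OF mono, of k "k + 1"] k K by (cases "k = K") auto
  show "c (k + 1) \<le> n + 1"
    using le[of "k + 1" K] k K by (cases "k = K") auto
qed

lemma sum_over_pieces:
  fixes f :: "nat \<Rightarrow> real"
  assumes pc: "piecewise_constant n K c \<theta>"
  shows "(\<Sum>k=1..K. \<Sum>i=c k..<c (k + 1). f i) = (\<Sum>i=1..n. f i)"
proof -
  have "1 \<le> c (j + 1) \<and> (\<Sum>k=1..j. \<Sum>i=c k..<c (k + 1). f i) = (\<Sum>i=1..<c (j + 1). f i)" if "j \<le> K" for j
    using that
  proof (induction j)
    case 0
    then show ?case using pc by (simp add: piecewise_constant_def)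
  next
    case (Suc j)
    have "c (Suc j) < c (Suc j + 1)" using piecewise_constant_bounds(2)[OF pc, of "Suc j"] Suc.prems by simp
    moreover have IH: "1 \<le> c (Suc j)" "(\<Sum>k=1..j. \<Sum>i=c k..<c (k + 1). f i) = (\<Sum>i=1..<c (Suc j). f i)"
      using Suc by auto
    ultimately show ?case
      using sum.atLeastLessThan_concat[of 1 "c (Suc j)" "c (Suc j + 1)" f] by simp
  qed
  from this[of K] have "(\<Sum>k=1..K. \<Sum>i=c k..<c (k + 1). f i) = (\<Sum>i=1..<n + 1. f i)"
    using pc by (simp add: piecewise_constant_def)
  also have "{1..<n + 1} = {1..n}" by auto
  finally show ?thesis .
qed

lemma sum_piece_lengths:
  assumes "piecewise_constant n K c \<theta>"
  shows "(\<Sum>k=1..K. real (piece_length c k)) = real n"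
  using sum_over_pieces[OF assms, of "\<lambda>_. 1"] by (simp add: piece_length_def)

lemma tv_error_bound:
  assumes min: "tv_minimizer n lam y u" and lam: "0 < lam" and A: "0 \<le> A"
    and pc: "piecewise_constant n K c \<theta>"
    and noise: "\<And>l r. 1 \<le> l \<Longrightarrow> l \<le> r \<Longrightarrow> r \<le> n \<Longrightarrow>
        \<bar>\<Sum>j=l..r. y j - \<theta> j\<bar> \<le> A * sqrt (real (r - l + 1))"
  shows "(\<Sum>i=1..n. (u i - \<theta> i)\<^sup>2) \<le> real n * (A ^ 4 / (64 * lam\<^sup>2))
      + (\<Sum>k=1..K. A\<^sup>2 * (4 + 2 * ln (real (piece_length c k))))
      + 8 * lam\<^sup>2 * (\<Sum>k=1..K. 1 / real (piece_length c k))"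
proof -
  have piece: "(\<Sum>i=c k..<c (k + 1). (u i - \<theta> i)\<^sup>2) \<le> real (piece_length c k) * (A ^ 4 / (64 * lam\<^sup>2))
      + A\<^sup>2 * (4 + 2 * ln (real (piece_length c k))) + 8 * lam\<^sup>2 * (1 / real (piece_length c k))"
    if k: "k \<in> {1..K}" for k
  proof -
    note cb = piecewise_constant_bounds[OF pc k]
    define b where "b = c (k + 1) - 1"
    have b: "c k \<le> b" "b \<le> n" "{c k..<c (k + 1)} = {c k..b}" "piece_length c k = b - c k + 1"
      using cb by (auto simp: b_def piece_length_def)
    have "\<forall>j\<in>{c k..<c (k + 1)}. \<theta> j = \<theta> (c k)" using pc k unfolding piecewise_constant_def by blast
    then have const: "\<theta> j = \<theta> (c k)" if "j \<in> {c k..b}" for j using that unfolding b(3) by blast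
    have "(\<Sum>i=c k..b. (u i - \<theta> i)\<^sup>2) \<le> (\<Sum>i=c k..b. piece_bound lam A (c k) b i)"
    proof (rule sum_mono)
      fix i assume i: "i \<in> {c k..b}"
      have "(u i - \<theta> (c k))\<^sup>2 \<le> piece_bound lam A (c k) b i"
        by (rule squared_error_bound[OF min lam A noise const cb(1)]) (use i b(2) in simp_all)
      then show "(u i - \<theta> i)\<^sup>2 \<le> piece_bound lam A (c k) b i" using const[OF i] by simp
    qed
    then show ?thesis using sum_piece_bound[OF b(1), of lam A] unfolding b(3,4) by linarith
  qed
  have "(\<Sum>i=1..n. (u i - \<theta> i)\<^sup>2) = (\<Sum>k=1..K. \<Sum>i=c k..<c (k + 1). (u i - \<theta> i)\<^sup>2)"
    by (rule sum_over_pieces[OF pc, symmetric])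
  also have "\<dots> \<le> (\<Sum>k=1..K. real (piece_length c k) * (A ^ 4 / (64 * lam\<^sup>2))
      + A\<^sup>2 * (4 + 2 * ln (real (piece_length c k))) + 8 * lam\<^sup>2 * (1 / real (piece_length c k)))"
    by (intro sum_mono piece)
  also have "\<dots> = (\<Sum>k=1..K. real (piece_length c k)) * (A ^ 4 / (64 * lam\<^sup>2))
      + (\<Sum>k=1..K. A\<^sup>2 * (4 + 2 * ln (real (piece_length c k))))
      + 8 * lam\<^sup>2 * (\<Sum>k=1..K. 1 / real (piece_length c k))"
    unfolding sum.distrib sum_distrib_left sum_distrib_right ..
  finally show ?thesis unfolding sum_piece_lengths[OF pc] .
qed

text \<open>Specialisation to the noise level \<open>A\<^sup>2 = 4 * \<sigma>\<^sup>2 * \<Lambda>\<close>. Since \<open>ln m = ln 2 + ln (m / 2)\<close>, the bound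
  on a piece of length \<open>m\<close> is an affine function of \<open>ln (m / 2)\<close>, and is compared with the right-hand
  side piece by piece.\<close>

lemma error_bound_le:
  fixes L \<Lambda> \<sigma> A lam :: real and m :: "nat \<Rightarrow> nat"
  assumes A: "A\<^sup>2 = 4 * \<sigma>\<^sup>2 * \<Lambda>" and nonneg: "0 \<le> L" "0 \<le> \<Lambda>"
    and m: "\<And>k. k \<in> {1..K} \<Longrightarrow> 1 \<le> m k"
  shows "real n * (A ^ 4 / (64 * lam\<^sup>2)) + (\<Sum>k=1..K. A\<^sup>2 * (4 + 2 * ln (real (m k))))
        + 8 * lam\<^sup>2 * (\<Sum>k=1..K. 1 / real (m k))
      \<le> 192 * \<sigma>\<^sup>2 * (L + 1 / 2 * \<Lambda>) * (real K + (\<Sum>k=1..K. ln (real (m k) / 2)))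
        + 24 * real n * \<sigma> ^ 4 * ((L\<^sup>2 + 1 / 4 * \<Lambda>\<^sup>2) / lam\<^sup>2)
        + 12 * real K * \<sigma>\<^sup>2 * \<Lambda> + 24 * lam\<^sup>2 * (\<Sum>k=1..K. 1 / real (m k))"
proof -
  have "A ^ 4 = (A\<^sup>2)\<^sup>2" by simp
  also have "\<dots> = 16 * (\<sigma> ^ 4 * \<Lambda>\<^sup>2)" unfolding A by (simp add: power_mult_distrib)
  finally have A4: "A ^ 4 = 16 * (\<sigma> ^ 4 * \<Lambda>\<^sup>2)" .
  define W where "W = L\<^sup>2 + 1 / 4 * \<Lambda>\<^sup>2"
  have "A ^ 4 / (64 * lam\<^sup>2) = (\<sigma> ^ 4 / lam\<^sup>2) * (1 / 4 * \<Lambda>\<^sup>2)" by (simp add: A4 mult.commute)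
  also have "\<dots> \<le> (\<sigma> ^ 4 / lam\<^sup>2) * (24 * W)"
    unfolding W_def by (intro mult_left_mono) auto
  finally have "real n * (A ^ 4 / (64 * lam\<^sup>2)) \<le> real n * ((\<sigma> ^ 4 / lam\<^sup>2) * (24 * W))"
    by (rule mult_left_mono) simp
  also have "\<dots> = 24 * real n * \<sigma> ^ 4 * (W / lam\<^sup>2)" by simp
  finally have t1: "real n * (A ^ 4 / (64 * lam\<^sup>2)) \<le> 24 * real n * \<sigma> ^ 4 * ((L\<^sup>2 + 1 / 4 * \<Lambda>\<^sup>2) / lam\<^sup>2)"
    unfolding W_def .
  have "A\<^sup>2 * (4 + 2 * ln (real (m k))) \<le> 192 * \<sigma>\<^sup>2 * (L + 1 / 2 * \<Lambda>) * (1 + ln (real (m k) / 2)) + 12 * \<sigma>\<^sup>2 * \<Lambda>"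
    if k: "k \<in> {1..K}" for k
  proof -
    \<comment> \<open>A piece of length \<open>1\<close> has \<open>x = - ln 2\<close>, so the factor \<open>1 + x\<close> stays positive but can be below \<open>1\<close>.\<close>
    define x where "x = ln (real (m k) / 2)"
    have mk: "1 \<le> real (m k)" using m[OF k] by simp
    then have lnm: "ln (real (m k)) = x + ln 2" by (simp add: x_def ln_div)
    have "0 \<le> ln (real (m k))" using mk by simp
    then have x: "- (3 / 4) \<le> x" and l2: "ln 2 \<le> (3 / 4 :: real)" using lnm ln2_le_25_over_36 by linarith+
    have "A\<^sup>2 * (4 + 2 * ln (real (m k))) = \<sigma>\<^sup>2 * \<Lambda> * (16 + 8 * (x + ln 2))"
      by (simp add: A lnm algebra_simps)
    also have "\<dots> \<le> \<sigma>\<^sup>2 * \<Lambda> * (96 * (1 + x) + 12)"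
      using x l2 nonneg by (intro mult_left_mono) auto
    also have "\<dots> = 192 * \<sigma>\<^sup>2 * (1 / 2 * \<Lambda>) * (1 + x) + 12 * \<sigma>\<^sup>2 * \<Lambda>" by (simp add: algebra_simps)
    also have "192 * \<sigma>\<^sup>2 * (1 / 2 * \<Lambda>) * (1 + x) \<le> 192 * \<sigma>\<^sup>2 * (L + 1 / 2 * \<Lambda>) * (1 + x)"
      using nonneg x by (intro mult_right_mono mult_left_mono) auto
    finally show ?thesis by (simp add: x_def)
  qed
  then have "(\<Sum>k=1..K. A\<^sup>2 * (4 + 2 * ln (real (m k))))
      \<le> (\<Sum>k=1..K. 192 * \<sigma>\<^sup>2 * (L + 1 / 2 * \<Lambda>) * (1 + ln (real (m k) / 2)) + 12 * \<sigma>\<^sup>2 * \<Lambda>)"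
    by (intro sum_mono)
  also have "\<dots> = 192 * \<sigma>\<^sup>2 * (L + 1 / 2 * \<Lambda>) * (real K + (\<Sum>k=1..K. ln (real (m k) / 2))) + 12 * real K * \<sigma>\<^sup>2 * \<Lambda>"
    unfolding sum.distrib sum_distrib_left[symmetric] by simp
  finally have t2: "(\<Sum>k=1..K. A\<^sup>2 * (4 + 2 * ln (real (m k))))
      \<le> 192 * \<sigma>\<^sup>2 * (L + 1 / 2 * \<Lambda>) * (real K + (\<Sum>k=1..K. ln (real (m k) / 2))) + 12 * real K * \<sigma>\<^sup>2 * \<Lambda>" .
  have t3: "8 * lam\<^sup>2 * (\<Sum>k=1..K. 1 / real (m k)) \<le> 24 * lam\<^sup>2 * (\<Sum>k=1..K. 1 / real (m k))"
    by (intro mult_right_mono) (auto intro: sum_nonneg)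
  from t1 t2 t3 show ?thesis by linarith
qed

section \<open>Sub-Gaussian sums\<close>

text \<open>By independence the moment generating function of the sum is a product, so the variance proxies
  \<open>\<sigma>\<^sup>2\<close> add up.\<close>

lemma (in prob_space) sub_gaussian_sum:
  assumes J: "finite J" and indep: "indep_vars (\<lambda>_. borel) X J"
    and sub: "\<And>j. j \<in> J \<Longrightarrow> sub_gaussian M (X j) \<sigma>"
  shows "sub_gaussian M (\<lambda>\<omega>. \<Sum>j\<in>J. X j \<omega>) (\<sigma> * sqrt (real (card J)))"
proof -
  have int: "integrable M (X j)" if "j \<in> J" for j using sub[OF that] by (simp add: sub_gaussian_def)
  have mean: "expectation (\<lambda>\<omega>. \<Sum>j\<in>J. X j \<omega>) = (\<Sum>j\<in>J. expectation (X j))"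
    using int by (simp add: Bochner_Integration.integral_sum)
  define Y where "Y s j = (\<lambda>\<omega>. exp (s * (X j \<omega> - expectation (X j))))" for s j
  have indepY: "indep_vars (\<lambda>_. borel) (Y s) J" for s
    unfolding Y_def by (rule indep_vars_compose2[OF indep, where Y = "\<lambda>j x. exp (s * (x - expectation (X j)))"]) simp
  have intY: "integrable M (Y s j)" and momY: "expectation (Y s j) \<le> exp (\<sigma>\<^sup>2 * s\<^sup>2 / 2)" if "j \<in> J" for s j
    using sub[OF that] by (auto simp: sub_gaussian_def Y_def)
  have factor: "exp (s * ((\<Sum>j\<in>J. X j \<omega>) - (\<Sum>j\<in>J. expectation (X j)))) = (\<Prod>j\<in>J. Y s j \<omega>)" for s \<omega>
    using J by (simp add: Y_def exp_sum[symmetric] sum_subtractf[symmetric] sum_distrib_left)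
  have "expectation (\<lambda>\<omega>. \<Prod>j\<in>J. Y s j \<omega>) \<le> exp ((\<sigma> * sqrt (real (card J)))\<^sup>2 * s\<^sup>2 / 2)" for s
  proof -
    have "expectation (\<lambda>\<omega>. \<Prod>j\<in>J. Y s j \<omega>) = (\<Prod>j\<in>J. expectation (Y s j))"
      using J intY indepY by (intro indep_vars_lebesgue_integral) auto
    also have "\<dots> \<le> (\<Prod>j\<in>J. exp (\<sigma>\<^sup>2 * s\<^sup>2 / 2))"
      using momY by (intro prod_mono) (auto simp: Y_def)
    also have "\<dots> = exp ((\<sigma> * sqrt (real (card J)))\<^sup>2 * s\<^sup>2 / 2)"
      by (simp add: exp_of_nat_mult[symmetric] power_mult_distrib algebra_simps)
    finally show ?thesis .
  qed
  moreover have "integrable M (\<lambda>\<omega>. \<Prod>j\<in>J. Y s j \<omega>)" for s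
    using J intY indepY by (intro indep_vars_integrable) auto
  ultimately show ?thesis using int by (simp add: sub_gaussian_def mean factor)
qed

lemma sub_gaussian_uminus:
  assumes "sub_gaussian M X \<sigma>"
  shows "sub_gaussian M (\<lambda>\<omega>. - X \<omega>) \<sigma>"
proof -
  have "exp (s * (- X \<omega> - (\<integral>\<omega>. - X \<omega> \<partial>M))) = exp ((- s) * (X \<omega> - (\<integral>\<omega>. X \<omega> \<partial>M)))" for s \<omega>
    by (simp add: algebra_simps)
  moreover have "(- s)\<^sup>2 = s\<^sup>2" for s :: real by simp
  ultimately show ?thesis using assms unfolding sub_gaussian_def
    by (metis (no_types, lifting) Bochner_Integration.integral_cong Bochner_Integration.integrable_cong integrable_minus)
qed

text \<open>Chernoff's bound at the optimal exponent \<open>s = A / \<sigma>\<close>.\<close>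

lemma (in prob_space) sub_gaussian_upper_tail:
  assumes sub: "sub_gaussian M X \<sigma>" and "0 < \<sigma>" "0 < A"
  shows "prob {\<omega> \<in> space M. A * \<sigma> \<le> X \<omega> - expectation X} \<le> exp (- A\<^sup>2 / 2)"
proof -
  define s where "s = A / \<sigma>"
  let ?E = "\<lambda>\<omega>. exp (s * (X \<omega> - expectation X))"
  have int: "integrable M ?E" and mom: "expectation ?E \<le> exp (\<sigma>\<^sup>2 * s\<^sup>2 / 2)"
    using sub by (auto simp: sub_gaussian_def)
  have eq: "{\<omega> \<in> space M. A * \<sigma> \<le> X \<omega> - expectation X} = {\<omega> \<in> space M. exp (A\<^sup>2) \<le> ?E \<omega>}"
  proof -
    have "exp (A\<^sup>2) \<le> exp (s * d) \<longleftrightarrow> A * (A * \<sigma>) \<le> A * d" for d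
      using assms(2) by (simp add: s_def pos_le_divide_eq power2_eq_square algebra_simps)
    then show ?thesis using assms(3) by simp
  qed
  have "prob {\<omega> \<in> space M. exp (A\<^sup>2) \<le> ?E \<omega>} \<le> expectation ?E / exp (A\<^sup>2)"
    using int by (intro integral_Markov_inequality_measure[of M _ "{}"]) auto
  also have "\<dots> \<le> exp (\<sigma>\<^sup>2 * s\<^sup>2 / 2) / exp (A\<^sup>2)" using mom by (simp add: divide_right_mono)
  also have "\<dots> = exp (\<sigma>\<^sup>2 * s\<^sup>2 / 2 - A\<^sup>2)" by (simp add: exp_diff)
  also have "\<sigma>\<^sup>2 * s\<^sup>2 / 2 - A\<^sup>2 = - A\<^sup>2 / 2" using \<open>0 < \<sigma>\<close> by (simp add: s_def power_divide)
  finally show ?thesis unfolding eq .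
qed

lemma (in prob_space) sub_gaussian_tail:
  assumes sub: "sub_gaussian M X \<sigma>" and "0 < \<sigma>" "0 < A"
  shows "prob {\<omega> \<in> space M. A * \<sigma> \<le> \<bar>X \<omega> - expectation X\<bar>} \<le> 2 * exp (- A\<^sup>2 / 2)"
proof -
  have meas [measurable]: "X \<in> borel_measurable M" using sub by (auto simp: sub_gaussian_def)
  let ?U = "{\<omega> \<in> space M. A * \<sigma> \<le> X \<omega> - expectation X}"
  let ?L = "{\<omega> \<in> space M. A * \<sigma> \<le> - X \<omega> - expectation (\<lambda>\<omega>. - X \<omega>)}"
  have "{\<omega> \<in> space M. A * \<sigma> \<le> \<bar>X \<omega> - expectation X\<bar>} = ?U \<union> ?L" by (auto simp: abs_real_def)
  moreover have "prob (?U \<union> ?L) \<le> prob ?U + prob ?L" by (intro measure_Un_le) measurable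
  ultimately have "prob {\<omega> \<in> space M. A * \<sigma> \<le> \<bar>X \<omega> - expectation X\<bar>} \<le> prob ?U + prob ?L" by simp
  also have "\<dots> \<le> exp (- A\<^sup>2 / 2) + exp (- A\<^sup>2 / 2)"
    using assms sub_gaussian_uminus[OF sub] by (intro add_mono sub_gaussian_upper_tail)
  finally show ?thesis by simp
qed

text \<open>The sum over an interval is compared with its own sub-Gaussian scale, so each interval fails with
  the same probability and a plain union bound over the at most \<open>n\<^sup>2\<close> intervals applies.\<close>

lemma (in prob_space) interval_sums_bounded:
  assumes indep: "indep_vars (\<lambda>_. borel) X {1..n}"
    and mean: "\<And>i. i \<in> {1..n} \<Longrightarrow> expectation (X i) = 0"
    and sub: "\<And>i. i \<in> {1..n} \<Longrightarrow> sub_gaussian M (X i) \<sigma>" and \<sigma>: "0 < \<sigma>" and A: "0 < A"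
  defines "bad \<equiv> {\<omega> \<in> space M. \<exists>l\<in>{1..n}. \<exists>r\<in>{l..n}. A * \<sigma> * sqrt (real (r - l + 1)) \<le> \<bar>\<Sum>j=l..r. X j \<omega>\<bar>}"
  shows "bad \<in> events" and "prob bad \<le> (real n)\<^sup>2 * (2 * exp (- A\<^sup>2 / 2))"
proof -
  define E where "E p = {\<omega> \<in> space M. fst p \<le> snd p \<and>
      A * \<sigma> * sqrt (real (snd p - fst p + 1)) \<le> \<bar>\<Sum>j=fst p..snd p. X j \<omega>\<bar>}" for p
  have meas: "X j \<in> borel_measurable M" if "j \<in> {1..n}" for j
    using sub[OF that] by (auto simp: sub_gaussian_def)
  let ?P = "{1..n} \<times> {1..n}"
  have bad_eq: "bad = (\<Union>p\<in>?P. E p)" by (fastforce simp: bad_def E_def)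
  have ev: "E p \<in> events" if "p \<in> ?P" for p
  proof -
    have "(\<lambda>\<omega>. \<Sum>j=fst p..snd p. X j \<omega>) \<in> borel_measurable M"
      using that by (intro borel_measurable_sum meas) auto
    then show ?thesis unfolding E_def by measurable
  qed
  then show "bad \<in> events" unfolding bad_eq by (intro sets.finite_UN) auto
  have bound: "prob (E p) \<le> 2 * exp (- A\<^sup>2 / 2)" if p: "p \<in> ?P" for p
  proof (cases "fst p \<le> snd p")
    case True
    define J where "J = {fst p..snd p}"
    have J: "finite J" "J \<subseteq> {1..n}" "card J = snd p - fst p + 1" using p True by (auto simp: J_def)
    have "sub_gaussian M (\<lambda>\<omega>. \<Sum>j\<in>J. X j \<omega>) (\<sigma> * sqrt (real (card J)))"
      using J sub by (intro sub_gaussian_sum indep_vars_subset[OF indep]) auto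
    moreover have "expectation (\<lambda>\<omega>. \<Sum>j\<in>J. X j \<omega>) = (\<Sum>j\<in>J. expectation (X j))"
      using J sub by (intro Bochner_Integration.integral_sum) (auto simp: sub_gaussian_def)
    then have "expectation (\<lambda>\<omega>. \<Sum>j\<in>J. X j \<omega>) = 0" using J mean by (simp add: subset_iff)
    moreover have "0 < \<sigma> * sqrt (real (card J))" using \<sigma> J(3) by simp
    ultimately have "prob {\<omega> \<in> space M. A * (\<sigma> * sqrt (real (card J))) \<le> \<bar>\<Sum>j\<in>J. X j \<omega>\<bar>} \<le> 2 * exp (- A\<^sup>2 / 2)"
      using sub_gaussian_tail[of "\<lambda>\<omega>. \<Sum>j\<in>J. X j \<omega>" "\<sigma> * sqrt (real (card J))" A] A by simp
    then show ?thesis using True unfolding E_def J(3) by (simp add: J_def mult.assoc)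
  next
    case False
    then have "E p = {}" by (simp add: E_def)
    then show ?thesis by simp
  qed
  have "prob bad \<le> (\<Sum>p\<in>?P. prob (E p))"
    unfolding bad_eq using ev by (intro measure_UNION_le) auto
  also have "\<dots> \<le> (\<Sum>p\<in>?P. 2 * exp (- A\<^sup>2 / 2))" by (intro sum_mono bound)
  also have "\<dots> = (real n)\<^sup>2 * (2 * exp (- A\<^sup>2 / 2))" by (simp add: power2_eq_square)
  finally show "prob bad \<le> (real n)\<^sup>2 * (2 * exp (- A\<^sup>2 / 2))" .
qed

section \<open>The high-probability error bound\<close>

theorem corollary5:
  fixes M :: "'w measure"
    and n K :: nat
    and c :: "nat \<Rightarrow> nat"
    and \<theta>s :: "nat \<Rightarrow> real"
    and \<epsilon> y :: "nat \<Rightarrow> 'w \<Rightarrow> real"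
    and \<theta>hat :: "'w \<Rightarrow> nat \<Rightarrow> real"
    and lam \<sigma> \<delta> :: real
  assumes "prob_space M"
    and "lam > 0" and "\<sigma> > 0"
    and "piecewise_constant n K c \<theta>s"
    and "prob_space.indep_vars M (\<lambda>_. borel) \<epsilon> {1..n}"
    and "\<And>i j. i \<in> {1..n} \<Longrightarrow> j \<in> {1..n} \<Longrightarrow> distr M borel (\<epsilon> i) = distr M borel (\<epsilon> j)"
    and "\<And>i. i \<in> {1..n} \<Longrightarrow> (\<integral>\<omega>. \<epsilon> i \<omega> \<partial>M) = 0"
    and "\<And>i. i \<in> {1..n} \<Longrightarrow> sub_gaussian M (\<epsilon> i) \<sigma>"
    and "\<And>i \<omega>. i \<in> {1..n} \<Longrightarrow> \<omega> \<in> space M \<Longrightarrow> y i \<omega> = \<theta>s i + \<epsilon> i \<omega>"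
    and "\<And>\<omega>. \<omega> \<in> space M \<Longrightarrow> \<theta>hat \<omega> = tv_estimator n lam (\<lambda>i. y i \<omega>)"
    and "0 < \<delta>" and "\<delta> < real n * (ln 2 / exp 1)\<^sup>2"
  shows "measure M {\<omega> \<in> space M.
           (\<Sum>i=1..n. \<bar>\<theta>hat \<omega> i - \<theta>s i\<bar>\<^sup>2)
             \<le> 192 * \<sigma>\<^sup>2 * (ln (ln (2 * real n)) + 1 / 2 * ln (real n / \<delta>))
                 * (real K + (\<Sum>k=1..K. ln (real (piece_length c k) / 2)))
               + 24 * real n * \<sigma> ^ 4
                 * (((ln (ln (2 * real n)))\<^sup>2 + 1 / 4 * (ln (real n / \<delta>))\<^sup>2) / lam\<^sup>2)
               + 12 * real K * \<sigma>\<^sup>2 * ln (real n / \<delta>)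
               + 24 * lam\<^sup>2 * (\<Sum>k=1..K. 1 / real (piece_length c k))}
         \<ge> 1 - 4 * (1 + 24 / (ln 2)\<^sup>2) * \<delta>"
proof -
  interpret prob_space M by fact
  note lam = assms(2) and \<sigma> = assms(3) and pc = assms(4) and indep = assms(5) and mean = assms(7)
    and sub = assms(8) and y = assms(9) and hat = assms(10) and \<delta> = assms(11) and \<delta>_le = assms(12)
  define \<Lambda> where "\<Lambda> = ln (real n / \<delta>)"
  define L where "L = ln (ln (2 * real n))"
  define loss where "loss \<omega> = (\<Sum>i=1..n. \<bar>\<theta>hat \<omega> i - \<theta>s i\<bar>\<^sup>2)" for \<omega>
  define R where "R = 192 * \<sigma>\<^sup>2 * (L + 1 / 2 * \<Lambda>) * (real K + (\<Sum>k=1..K. ln (real (piece_length c k) / 2)))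
      + 24 * real n * \<sigma> ^ 4 * ((L\<^sup>2 + 1 / 4 * \<Lambda>\<^sup>2) / lam\<^sup>2) + 12 * real K * \<sigma>\<^sup>2 * \<Lambda>
      + 24 * lam\<^sup>2 * (\<Sum>k=1..K. 1 / real (piece_length c k))"
  have "1 \<le> c K" using piecewise_constant_bounds(1)[OF pc, of K] pc by (simp add: piecewise_constant_def)
  then have n2: "2 \<le> n" using pc by (simp add: piecewise_constant_def)
  have "ln 2 \<le> exp (1 :: real)" using ln_2_less_1 exp_ge_add_one_self[of 1] by linarith
  then have "(ln 2 / exp 1)\<^sup>2 \<le> (1 :: real)" by (intro power_le_one) auto
  then have "real n * (ln 2 / exp 1)\<^sup>2 \<le> real n" by (simp add: mult_left_le)
  then have "\<delta> < real n" using \<delta>_le by linarith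
  then have \<Lambda>: "0 < \<Lambda>" using \<delta> by (simp add: \<Lambda>_def)
  have "exp 1 \<le> 2 * real n" using exp_le n2 by linarith
  then have "1 \<le> ln (2 * real n)" using n2 by (subst ln_ge_iff) auto
  then have L: "0 \<le> L" by (simp add: L_def)

  \<comment> \<open>At this level a single interval fails with probability at most \<open>2 * (\<delta> / n)\<^sup>2\<close>, which absorbs the
    \<open>n\<^sup>2\<close> intervals of the union bound.\<close>
  define A where "A = 2 * sqrt \<Lambda>"
  define bad where "bad = {\<omega> \<in> space M. \<exists>l\<in>{1..n}. \<exists>r\<in>{l..n}.
      A * \<sigma> * sqrt (real (r - l + 1)) \<le> \<bar>\<Sum>j=l..r. \<epsilon> j \<omega>\<bar>}"
  have A: "0 < A" "A\<^sup>2 = 4 * \<Lambda>" using \<Lambda> by (simp_all add: A_def power_mult_distrib)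
  have bad_event: "bad \<in> events"
    unfolding bad_def by (rule interval_sums_bounded(1)[OF indep mean sub \<sigma> A(1)])
  have "prob bad \<le> (real n)\<^sup>2 * (2 * exp (- A\<^sup>2 / 2))"
    unfolding bad_def by (rule interval_sums_bounded(2)[OF indep mean sub \<sigma> A(1)])
  also have "exp (- A\<^sup>2 / 2) = (exp (- \<Lambda>))\<^sup>2" unfolding A(2) by (simp add: exp_double[symmetric])
  also have "exp (- \<Lambda>) = \<delta> / real n" using \<delta> n2 by (simp add: \<Lambda>_def exp_minus)
  also have "(real n)\<^sup>2 * (2 * (\<delta> / real n)\<^sup>2) = 2 * \<delta>\<^sup>2" using n2 by (simp add: power_divide)
  finally have bad_prob: "prob bad \<le> 2 * \<delta>\<^sup>2" .

  have good: "loss \<omega> \<le> R" if \<omega>: "\<omega> \<in> space M" "\<omega> \<notin> bad" for \<omega>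
  proof -
    have "tv_minimizer n lam (\<lambda>i. y i \<omega>) (\<theta>hat \<omega>)"
      unfolding hat[OF \<omega>(1)] by (rule tv_minimizer_tv_estimator[OF lam])
    moreover have "\<bar>\<Sum>j=l..r. y j \<omega> - \<theta>s j\<bar> \<le> A * \<sigma> * sqrt (real (r - l + 1))"
      if lr: "1 \<le> l" "l \<le> r" "r \<le> n" for l r
    proof -
      have "(\<Sum>j=l..r. y j \<omega> - \<theta>s j) = (\<Sum>j=l..r. \<epsilon> j \<omega>)"
        using y[OF _ \<omega>(1)] lr by (intro sum.cong) auto
      moreover have "l \<in> {1..n}" "r \<in> {l..n}" using lr by auto
      then have "\<not> A * \<sigma> * sqrt (real (r - l + 1)) \<le> \<bar>\<Sum>j=l..r. \<epsilon> j \<omega>\<bar>"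
        using \<omega> unfolding bad_def by blast
      ultimately show ?thesis by simp
    qed
    moreover have "0 \<le> A * \<sigma>" using A \<sigma> by simp
    ultimately have "(\<Sum>i=1..n. (\<theta>hat \<omega> i - \<theta>s i)\<^sup>2) \<le> real n * ((A * \<sigma>) ^ 4 / (64 * lam\<^sup>2))
      + (\<Sum>k=1..K. (A * \<sigma>)\<^sup>2 * (4 + 2 * ln (real (piece_length c k))))
      + 8 * lam\<^sup>2 * (\<Sum>k=1..K. 1 / real (piece_length c k))"
      using lam pc by (intro tv_error_bound[where y = "\<lambda>i. y i \<omega>"])
    also have "\<dots> \<le> R"
      unfolding R_def
    proof (rule error_bound_le)
      show "(A * \<sigma>)\<^sup>2 = 4 * \<sigma>\<^sup>2 * \<Lambda>" by (simp add: power_mult_distrib A(2))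
      show "1 \<le> piece_length c k" if "k \<in> {1..K}" for k
        using piecewise_constant_bounds(2)[OF pc that] by (simp add: piece_length_def)
    qed (use L \<Lambda> in auto)
    finally show ?thesis by (simp add: loss_def)
  qed

  have hat_meas: "(\<lambda>\<omega>. \<theta>hat \<omega> i) \<in> borel_measurable M" if i: "i \<in> {1..n}" for i
  proof -
    \<comment> \<open>Outside \<open>{1..n}\<close> the data are arbitrary; they are set to \<open>0\<close> to get a measurable random vector.\<close>
    define z where "z \<omega> = (\<lambda>j. if j \<in> {1..n} then \<theta>s j + \<epsilon> j \<omega> else 0)" for \<omega>
    have eps: "\<epsilon> j \<in> borel_measurable M" if "j \<in> {1..n}" for j
      using sub[OF that] by (auto simp: sub_gaussian_def)
    have "z \<in> borel_measurable M"
    proof (rule measurable_coordinatewise_then_product)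
      fix j
      have "(\<lambda>\<omega>. z \<omega> j) = (if j \<in> {1..n} then (\<lambda>\<omega>. \<theta>s j + \<epsilon> j \<omega>) else (\<lambda>_. 0))"
        by (auto simp: z_def)
      then show "(\<lambda>\<omega>. z \<omega> j) \<in> borel_measurable M" using eps[of j] by simp
    qed
    moreover have "(\<lambda>x. tv_estimator n lam x i) \<in> borel_measurable borel"
      using continuous_on_tv_estimator[OF lam i] by (rule borel_measurable_continuous_onI)
    ultimately have "(\<lambda>\<omega>. tv_estimator n lam (z \<omega>) i) \<in> borel_measurable M"
      by (rule measurable_compose)
    moreover have "\<theta>hat \<omega> i = tv_estimator n lam (z \<omega>) i" if "\<omega> \<in> space M" for \<omega>
      unfolding hat[OF that]
      by (rule fun_cong[OF tv_estimator_cong]) (use y[OF _ that] in \<open>simp add: z_def\<close>)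
    ultimately show ?thesis by (simp cong: measurable_cong)
  qed
  have "loss \<in> borel_measurable M"
    unfolding loss_def using hat_meas
    by (intro borel_measurable_sum borel_measurable_power borel_measurable_abs borel_measurable_diff) auto
  then have event: "{\<omega> \<in> space M. loss \<omega> \<le> R} \<in> events" by measurable

  have "1 - 4 * (1 + 24 / (ln 2)\<^sup>2) * \<delta> \<le> prob {\<omega> \<in> space M. loss \<omega> \<le> R}"
  proof (cases "\<delta> \<le> 1")
    case True
    have "1 - prob bad = prob (space M - bad)" using prob_compl[OF bad_event] by simp
    also have "\<dots> \<le> prob {\<omega> \<in> space M. loss \<omega> \<le> R}"
      using event good by (intro finite_measure_mono) auto
    finally have "1 - 2 * \<delta>\<^sup>2 \<le> prob {\<omega> \<in> space M. loss \<omega> \<le> R}" using bad_prob by linarith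
    moreover have "\<delta>\<^sup>2 \<le> \<delta>" using True \<delta> by (simp add: power2_eq_square mult_left_le)
    moreover have "4 * 1 * \<delta> \<le> 4 * (1 + 24 / (ln 2)\<^sup>2) * \<delta>"
      using \<delta> by (intro mult_right_mono mult_left_mono) auto
    ultimately show ?thesis using \<delta> by linarith
  next
    \<comment> \<open>The asserted lower bound is negative.\<close>
    case False
    have "4 * 1 * 1 \<le> 4 * (1 + 24 / (ln 2)\<^sup>2) * \<delta>"
      using False by (intro mult_mono) auto
    then show ?thesis using measure_nonneg[of M "{\<omega> \<in> space M. loss \<omega> \<le> R}"] by linarith
  qed
  then show ?thesis unfolding loss_def R_def L_def \<Lambda>_def .
qed

end
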